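(* Consider the optimization problem (P) and the dynamical system (D) (the dynamical neural network) given in the context. If $(\tau^*,x^*,\beta^*,\chi^*,\zeta^*,\theta_1^*,\theta_2^*,\varrho^* )$ is an equilibrium point of (D), then $(\tau^*,x^* )$ is a KKT point of (P). Conversely, if $(\tau^*,x^* )$ is a KKT point of (P), then there exist $\beta^*\ge0$, $\chi^*\ge0$, $\zeta^*\ge0$, $\theta_1^*\ge0$, $\theta_2^*\ge0$, $\varrho^*\ge0$ such that $(\tau^*,x^*,\beta^*,\chi^*,\zeta^*,\theta_1^*,\theta_2^*,\varrho^* )$ is an equilibrium point of (D).
   Context: Data: $\mathcal S$ is a finite state space; for each $s\in\mathcal S$, $\mathcal A(s)$ is a finite set of actions; $\Lambda=\{(s,a): s\in\mathcal S,\ a\in\mathcal A(s)\}$; $p(s'|s,a)$ are transition probabilities; $q$ is a probability distribution on $\mathcal S$; $\alpha\in[0,1)$; $\delta$ is the Kronecker delta. For $k=0,\dots,K$: $\mu_k\in\mathbb R^{|\Lambda|}$, $\Sigma_k\in\mathbb R^{|\Lambda|\times|\Lambda|}$ is symmetric positive semidefinite and invertible, $\rho_{1,k},\rho_{2,k}\ge0$; $\xi_1,\dots,\xi_K\in\mathbb R$; $\hat\epsilon\in(0,1]$. $\|\cdot\|$ is the Euclidean norm. Functions, for $\tau\in\mathbb R^{|\Lambda|}$ and $x\in\mathbb R^K$: $f(\tau)=\frac1{1-\alpha}\big[-\tau^\top\mu_0+\sqrt{\rho_{1,0}}\|\Sigma_0^{1/2}\tau\|\big]$; $\phi_k(\tau,x)=\Big(\sqrt{\frac{e^{x_k}}{1-e^{x_k}}}\sqrt{\rho_{2,k}}+\sqrt{\rho_{1,k}}\Big)\|\Sigma_k^{1/2}\tau\|-\tau^\top\mu_k+\xi_k$,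 $k=1,\dots,K$; $g_k(x)=x_k$, $k=1,\dots,K$; $h(x)=\log\hat\epsilon-\sum_{k=1}^Kx_k$; $\omega_s(\tau)=\sum_{(s',a')\in\Lambda}\tau(s',a')(\delta(s,s')-\alpha p(s|s',a'))-(1-\alpha)q(s)$, $s\in\mathcal S$; $\nu(\tau)=-\tau\in\mathbb R^{|\Lambda|}$. Write $\phi=(\phi_1,\dots,\phi_K)^\top$, $g=(g_1,\dots,g_K)^\top$, $\omega=(\omega_s)_{s\in\mathcal S}$. The symbol $\nabla$ of a vector-valued function denotes its Jacobian matrix, $\nabla f$ is the gradient column vector, and $(\cdot)^+$ is the componentwise positive part. All points $(\tau,x)$ are taken in the region $\tau\neq0$, $x_k<0$ for all $k$, where these functions are differentiable. Problem (P): $\min_{\tau\in\mathbb R_+^{|\Lambda|},\,x\in\mathbb R_-^K} f(\tau)$ subject to $\phi_k(\tau,x)\le0$, $g_k(x)\le0$ ($k=1,\dots,K$), $h(x)\le0$, $\omega_s(\tau)\le0$, $-\omega_s(\tau)\le0$ ($s\in\mathcal S$), $\nu(\tau)\le0$. KKT point of (P): a feasible point $(\tau^*,x^* )$ for which there exist multipliers $\beta\in\mathbb R^K$, $\chi\in\mathbb R^K$, $\zeta\in\mathbb R$, $\theta_1,\theta_2\in\mathbb R^{|\mathcal S|}$, $\varrho\in\mathbb R^{|\Lambda|}$, all componentwise nonnegative, such that $\nabla f(\tau^* )+\nabla_\tau\phi(\tau^*,x^* )^\top\beta+\nabla\omega(\tau^* )^\top(\theta_1-\theta_2)+\nabla\nu(\tau^*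 )^\top\varrho=0$, $\nabla_x\phi(\tau^*,x^* )^\top\beta+\nabla g(x^* )^\top\chi+\nabla h(x^* )^\top\zeta=0$, and complementarity holds componentwise: $\beta_k\phi_k(\tau^*,x^* )=0$, $\chi_kg_k(x^* )=0$, $\zeta h(x^* )=0$, $\theta_{1,s}\omega_s(\tau^* )=0$, $\theta_{2,s}\omega_s(\tau^* )=0$, $\varrho_i\nu_i(\tau^* )=0$. Dynamical system (D), for $z=(\tau,x,\beta,\chi,\zeta,\theta_1,\theta_2,\varrho)$ as a function of time $t$: $\dot\tau=-\big(\nabla f(\tau)+\nabla_\tau\phi(\tau,x)^\top(\beta+\phi(\tau,x))^++\nabla\omega(\tau)^\top(\theta_1+\omega(\tau))^+-\nabla\omega(\tau)^\top(\theta_2-\omega(\tau))^++\nabla\nu(\tau)^\top(\varrho+\nu(\tau))^+\big)$, $\dot x=-\big(\nabla_x\phi(\tau,x)^\top(\beta+\phi(\tau,x))^++\nabla g(x)^\top(\chi+g(x))^++\nabla h(x)^\top(\zeta+h(x))^+\big)$, $\dot\beta=(\beta+\phi(\tau,x))^+-\beta$, $\dot\chi=(\chi+g(x))^+-\chi$, $\dot\zeta=(\zeta+h(x))^+-\zeta$, $\dot\theta_1=(\theta_1+\omega(\tau))^+-\theta_1$, $\dot\theta_2=(\theta_2-\omega(\tau))^+-\theta_2$, $\dot\varrho=(\varrho+\nu(\tau))^+-\varrho$. An equilibrium point of (D) is a point at which all right-hand sides vanish. *)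

theory Defs
  imports "HOL-Analysis.Analysis" "HOL-Probability.Probability_Mass_Function"
begin

definition pos_semidef_matrix :: "real^'n^'n \<Rightarrow> bool" where
  "pos_semidef_matrix S \<longleftrightarrow> transpose S = S \<and> (\<forall>v. 0 \<le> v \<bullet> (S *v v))"

text \<open>The symmetric positive semidefinite square root, meaningful when \<open>S\<close> is itself symmetric
  positive semidefinite (it then exists and is unique).\<close>

definition matrix_sqrt :: "real^'n^'n \<Rightarrow> real^'n^'n" where
  "matrix_sqrt S = (THE R. pos_semidef_matrix R \<and> R ** R = S)"

definition gradient :: "('v::real_inner \<Rightarrow> real) \<Rightarrow> 'v \<Rightarrow> 'v" where
  "gradient F v = (THE D. GDERIV F v :> D)"

definition pos_part :: "real^'n \<Rightarrow> real^'n" where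
  "pos_part v = (\<chi> i. max 0 (v $ i))"

text \<open>
  \<open>'s\<close> is the state space and \<open>'a\<close> the universe of actions. The finite set
  \<open>\<Lambda> = {(s, a). a \<in> \<A>(s)}\<close> depends on the data, so coordinates of vectors over \<open>\<Lambda>\<close> are named by a
  finite type \<open>'l\<close> through an enumeration \<open>pair :: 'l \<Rightarrow> 's \<times> 'a\<close>, required below to be a bijection
  onto \<open>\<Lambda>\<close>; thus \<open>\<real>\<^sup>\<Lambda>\<close> is \<open>real^'l\<close>. The type \<open>'k\<close> is the index set \<open>{1, \<dots>, K}\<close>. Families indexed
  by \<open>0, \<dots>, K\<close> are indexed by \<open>'k option\<close>, with \<open>None\<close> for the index \<open>0\<close>.
  \<open>trans_pmf s a\<close> is the distribution \<open>p(\<cdot> | s, a)\<close>; only its values for \<open>a \<in> \<A>(s)\<close> are ever used.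
\<close>

record ('s, 'a, 'l, 'k) mdp_data =
  actions :: "'s \<Rightarrow> 'a set"
  pair :: "'l \<Rightarrow> 's \<times> 'a"
  trans_pmf :: "'s \<Rightarrow> 'a \<Rightarrow> 's pmf"
  init_pmf :: "'s pmf"
  discount :: real
  mu :: "'k option \<Rightarrow> real^'l"
  Sig :: "'k option \<Rightarrow> real^'l^'l"
  rho1 :: "'k option \<Rightarrow> real"
  rho2 :: "'k option \<Rightarrow> real"
  xi :: "'k \<Rightarrow> real"
  eps :: real

definition Lambda :: "('s, 'a, 'l::finite, 'k) mdp_data \<Rightarrow> ('s \<times> 'a) set" where
  "Lambda M = (SIGMA s : UNIV. actions M s)"

definition valid_data :: "('s::finite, 'a, 'l::finite, 'k::finite) mdp_data \<Rightarrow> bool" where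
  "valid_data M \<longleftrightarrow>
     (\<forall>s. finite (actions M s)) \<and>
     bij_betw (pair M) UNIV (Lambda M) \<and>
     0 \<le> discount M \<and> discount M < 1 \<and>
     (\<forall>k. pos_semidef_matrix (Sig M k) \<and> invertible (Sig M k)) \<and>
     (\<forall>k. 0 \<le> rho1 M k \<and> 0 \<le> rho2 M k) \<and>
     0 < eps M \<and> eps M \<le> 1"

definition obj_f :: "('s, 'a, 'l::finite, 'k) mdp_data \<Rightarrow> real^'l \<Rightarrow> real" where
  "obj_f M \<tau> = 1 / (1 - discount M) *
     (- (\<tau> \<bullet> mu M None) + sqrt (rho1 M None) * norm (matrix_sqrt (Sig M None) *v \<tau>))"

definition con_phi ::
  "('s, 'a, 'l::finite, 'k::finite) mdp_data \<Rightarrow> real^'l \<Rightarrow> real^'k \<Rightarrow> real^'k" where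
  "con_phi M \<tau> x = (\<chi> k.
     (sqrt (exp (x $ k) / (1 - exp (x $ k))) * sqrt (rho2 M (Some k)) + sqrt (rho1 M (Some k)))
       * norm (matrix_sqrt (Sig M (Some k)) *v \<tau>)
     - \<tau> \<bullet> mu M (Some k) + xi M k)"

definition con_g :: "real^'k::finite \<Rightarrow> real^'k" where
  "con_g x = (\<chi> k. x $ k)"

definition con_h :: "('s, 'a, 'l::finite, 'k::finite) mdp_data \<Rightarrow> real^'k \<Rightarrow> real" where
  "con_h M x = ln (eps M) - (\<Sum>k\<in>UNIV. x $ k)"

definition con_omega ::
  "('s::finite, 'a, 'l::finite, 'k) mdp_data \<Rightarrow> real^'l \<Rightarrow> real^'s" where
  "con_omega M \<tau> = (\<chi> s.
     (\<Sum>i\<in>UNIV. let (s', a') = pair M i in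
        \<tau> $ i * ((if s = s' then 1 else 0) - discount M * pmf (trans_pmf M s' a') s))
     - (1 - discount M) * pmf (init_pmf M) s)"

definition con_nu :: "real^'l::finite \<Rightarrow> real^'l" where
  "con_nu \<tau> = - \<tau>"

text \<open>The order on vectors is the componentwise one.\<close>

definition feasible ::
  "('s::finite, 'a, 'l::finite, 'k::finite) mdp_data \<Rightarrow> real^'l \<Rightarrow> real^'k \<Rightarrow> bool" where
  "feasible M \<tau> x \<longleftrightarrow>
     0 \<le> \<tau> \<and> x \<le> 0 \<and>
     con_phi M \<tau> x \<le> 0 \<and> con_g x \<le> 0 \<and> con_h M x \<le> 0 \<and>
     con_omega M \<tau> \<le> 0 \<and> - con_omega M \<tau> \<le> 0 \<and> con_nu \<tau> \<le> 0"

definition KKT_point ::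
  "('s::finite, 'a, 'l::finite, 'k::finite) mdp_data \<Rightarrow> real^'l \<Rightarrow> real^'k \<Rightarrow> bool" where
  "KKT_point M \<tau> x \<longleftrightarrow> feasible M \<tau> x \<and>
     (\<exists>(\<beta>::real^'k) (\<eta>::real^'k) (\<zeta>::real) (\<theta>\<^sub>1::real^'s) (\<theta>\<^sub>2::real^'s) (\<rho>::real^'l).
        0 \<le> \<beta> \<and> 0 \<le> \<eta> \<and> 0 \<le> \<zeta> \<and> 0 \<le> \<theta>\<^sub>1 \<and> 0 \<le> \<theta>\<^sub>2 \<and> 0 \<le> \<rho> \<and>
        gradient (obj_f M) \<tau>
          + transpose (jacobian (\<lambda>t. con_phi M t x) (at \<tau>)) *v \<beta>
          + transpose (jacobian (con_omega M) (at \<tau>)) *v (\<theta>\<^sub>1 - \<theta>\<^sub>2)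
          + transpose (jacobian con_nu (at \<tau>)) *v \<rho> = 0 \<and>
        transpose (jacobian (con_phi M \<tau>) (at x)) *v \<beta>
          + transpose (jacobian con_g (at x)) *v \<eta>
          + \<zeta> *\<^sub>R gradient (con_h M) x = 0 \<and>
        (\<forall>k. \<beta> $ k * con_phi M \<tau> x $ k = 0) \<and>
        (\<forall>k. \<eta> $ k * con_g x $ k = 0) \<and>
        \<zeta> * con_h M x = 0 \<and>
        (\<forall>s. \<theta>\<^sub>1 $ s * con_omega M \<tau> $ s = 0) \<and>
        (\<forall>s. \<theta>\<^sub>2 $ s * con_omega M \<tau> $ s = 0) \<and>
        (\<forall>i. \<rho> $ i * con_nu \<tau> $ i = 0))"

text \<open>The system is \<open>z' = dnn_field M z\<close> for
  \<open>z = (\<tau>, x, \<beta>, \<eta>, \<zeta>, \<theta>\<^sub>1, \<theta>\<^sub>2, \<rho>)\<close>; \<open>\<eta>\<close> is the multiplier of \<open>g\<close> (the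
  name \<open>\<chi>\<close> is taken by the vector binder).\<close>

type_synonym ('s, 'l, 'k) dnn_state =
  "(real^'l) \<times> (real^'k) \<times> (real^'k) \<times> (real^'k) \<times> real \<times> (real^'s) \<times> (real^'s) \<times> (real^'l)"

definition dnn_field ::
  "('s::finite, 'a, 'l::finite, 'k::finite) mdp_data
     \<Rightarrow> ('s, 'l, 'k) dnn_state \<Rightarrow> ('s, 'l, 'k) dnn_state" where
  "dnn_field M = (\<lambda>(\<tau>, x, \<beta>, \<eta>, \<zeta>, \<theta>\<^sub>1, \<theta>\<^sub>2, \<rho>).
     (- (gradient (obj_f M) \<tau>
          + transpose (jacobian (\<lambda>t. con_phi M t x) (at \<tau>)) *v pos_part (\<beta> + con_phi M \<tau> x)
          + transpose (jacobian (con_omega M) (at \<tau>)) *v pos_part (\<theta>\<^sub>1 + con_omega M \<tau>)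
          - transpose (jacobian (con_omega M) (at \<tau>)) *v pos_part (\<theta>\<^sub>2 - con_omega M \<tau>)
          + transpose (jacobian con_nu (at \<tau>)) *v pos_part (\<rho> + con_nu \<tau>)),
      - (transpose (jacobian (con_phi M \<tau>) (at x)) *v pos_part (\<beta> + con_phi M \<tau> x)
          + transpose (jacobian con_g (at x)) *v pos_part (\<eta> + con_g x)
          + max 0 (\<zeta> + con_h M x) *\<^sub>R gradient (con_h M) x),
      pos_part (\<beta> + con_phi M \<tau> x) - \<beta>,
      pos_part (\<eta> + con_g x) - \<eta>,
      max 0 (\<zeta> + con_h M x) - \<zeta>,
      pos_part (\<theta>\<^sub>1 + con_omega M \<tau>) - \<theta>\<^sub>1,
      pos_part (\<theta>\<^sub>2 - con_omega M \<tau>) - \<theta>\<^sub>2,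
      pos_part (\<rho> + con_nu \<tau>) - \<rho>))"

definition equilibrium_point ::
  "('s::finite, 'a, 'l::finite, 'k::finite) mdp_data \<Rightarrow> ('s, 'l, 'k) dnn_state \<Rightarrow> bool" where
  "equilibrium_point M z \<longleftrightarrow> dnn_field M z = 0"

end

theory Submission
  imports Defs
begin

text \<open>A projected multiplier is stationary, \<open>(\<beta> + c)\<^sup>+ = \<beta>\<close>, exactly when \<open>\<beta>\<close> and \<open>-c\<close> are
  nonnegative and complementary. So the multiplier components of the field vanish iff primal
  feasibility, dual feasibility and complementarity hold, and on that set every positive part in the
  remaining components collapses to its multiplier, leaving the negated KKT stationarity conditions.\<close>

lemma max_add_eq_self_iff:
  fixes b c :: real
  shows "max 0 (b + c) = b \<longleftrightarrow> 0 \<le> b \<and> c \<le> 0 \<and> b * c = 0"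
  by (auto simp: max_def)

lemma pos_part_add_eq_self_iff:
  "pos_part (b + c) = b \<longleftrightarrow> 0 \<le> b \<and> c \<le> 0 \<and> (\<forall>i. b $ i * c $ i = 0)"
  by (simp add: pos_part_def vec_eq_iff less_eq_vec_def max_add_eq_self_iff) blast

text \<open>The sign conditions on \<tau> and x are \<open>con_nu\<close> and \<open>con_g\<close>
  in disguise. This leaves only inequalities c \<le> 0, the form in which the fixed-point equations
  of the multipliers deliver them.\<close>

lemma feasible_iff:
  "feasible M \<tau> x \<longleftrightarrow>
     con_phi M \<tau> x \<le> 0 \<and> con_g x \<le> 0 \<and> con_h M x \<le> 0 \<and>
     con_omega M \<tau> \<le> 0 \<and> - con_omega M \<tau> \<le> 0 \<and> con_nu \<tau> \<le> 0"
  by (auto simp: feasible_def con_g_def con_nu_def less_eq_vec_def)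

text \<open>For fixed multipliers the right side is the body of \<open>KKT_point\<close>. Gradients
  and Jacobians occur as the same terms on both sides, so the equivalence is purely algebraic and no
  derivative is evaluated.\<close>

lemma equilibrium_point_iff:
  "equilibrium_point M (\<tau>, x, \<beta>, \<eta>, \<zeta>, \<theta>\<^sub>1, \<theta>\<^sub>2, \<rho>) \<longleftrightarrow>
     feasible M \<tau> x \<and>
     0 \<le> \<beta> \<and> 0 \<le> \<eta> \<and> 0 \<le> \<zeta> \<and> 0 \<le> \<theta>\<^sub>1 \<and> 0 \<le> \<theta>\<^sub>2 \<and> 0 \<le> \<rho> \<and>
     gradient (obj_f M) \<tau>
       + transpose (jacobian (\<lambda>t. con_phi M t x) (at \<tau>)) *v \<beta>
       + transpose (jacobian (con_omega M) (at \<tau>)) *v (\<theta>\<^sub>1 - \<theta>\<^sub>2)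
       + transpose (jacobian con_nu (at \<tau>)) *v \<rho> = 0 \<and>
     transpose (jacobian (con_phi M \<tau>) (at x)) *v \<beta>
       + transpose (jacobian con_g (at x)) *v \<eta>
       + \<zeta> *\<^sub>R gradient (con_h M) x = 0 \<and>
     (\<forall>k. \<beta> $ k * con_phi M \<tau> x $ k = 0) \<and>
     (\<forall>k. \<eta> $ k * con_g x $ k = 0) \<and>
     \<zeta> * con_h M x = 0 \<and>
     (\<forall>s. \<theta>\<^sub>1 $ s * con_omega M \<tau> $ s = 0) \<and>
     (\<forall>s. \<theta>\<^sub>2 $ s * con_omega M \<tau> $ s = 0) \<and>
     (\<forall>i. \<rho> $ i * con_nu \<tau> $ i = 0)"
  (is "?eq \<longleftrightarrow> _")
proof -
  let ?fixed = "pos_part (\<beta> + con_phi M \<tau> x) = \<beta> \<and> pos_part (\<eta> + con_g x) = \<eta> \<and>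
    max 0 (\<zeta> + con_h M x) = \<zeta> \<and> pos_part (\<theta>\<^sub>1 + con_omega M \<tau>) = \<theta>\<^sub>1 \<and>
    pos_part (\<theta>\<^sub>2 - con_omega M \<tau>) = \<theta>\<^sub>2 \<and> pos_part (\<rho> + con_nu \<tau>) = \<rho>"
  let ?stat_\<tau> = "gradient (obj_f M) \<tau>
    + transpose (jacobian (\<lambda>t. con_phi M t x) (at \<tau>)) *v \<beta>
    + transpose (jacobian (con_omega M) (at \<tau>)) *v (\<theta>\<^sub>1 - \<theta>\<^sub>2)
    + transpose (jacobian con_nu (at \<tau>)) *v \<rho> = 0"
  let ?stat_x = "transpose (jacobian (con_phi M \<tau>) (at x)) *v \<beta>
    + transpose (jacobian con_g (at x)) *v \<eta> + \<zeta> *\<^sub>R gradient (con_h M) x = 0"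
  \<comment> \<open>The fixed-point criterion for the constraint function
    \<open>- con_omega M \<tau>\<close>; the sign drops out of the complementarity product.\<close>
  have minus_iff: "pos_part (\<theta>\<^sub>2 - con_omega M \<tau>) = \<theta>\<^sub>2 \<longleftrightarrow>
      0 \<le> \<theta>\<^sub>2 \<and> - con_omega M \<tau> \<le> 0 \<and> (\<forall>s. \<theta>\<^sub>2 $ s * con_omega M \<tau> $ s = 0)"
    using pos_part_add_eq_self_iff[of \<theta>\<^sub>2 "- con_omega M \<tau>"] by simp
  have "?eq \<longleftrightarrow> ?fixed \<and> ?stat_\<tau> \<and> ?stat_x"
  proof (cases ?fixed)
    case True
    then show ?thesis
      unfolding equilibrium_point_def dnn_field_def prod.case zero_prod_def prod.inject
      \<comment> \<open>The last six components become differences of equal terms; linearity merges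
        the two \<omega> terms into one in
        \<open>\<theta>\<^sub>1 - \<theta>\<^sub>2\<close>.\<close>
      by (simp only: matrix_vector_mult_diff_distrib neg_equal_0_iff_equal
          diff_self add_diff_eq simp_thms)
  next
    case False
    then show ?thesis
      \<comment> \<open>Both sides are false: some multiplier component of the field is
        nonzero.\<close>
      unfolding equilibrium_point_def dnn_field_def prod.case zero_prod_def prod.inject
        right_minus_eq by blast
  qed
  then show ?thesis
    unfolding pos_part_add_eq_self_iff max_add_eq_self_iff minus_iff feasible_iff by blast
qed

text \<open>The same multipliers witness both sides; feasibility does not mention them, so it moves
  across the existential quantifiers.\<close>

lemma KKT_point_iff_equilibrium_point:
  "KKT_point M \<tau> x \<longleftrightarrow>
     (\<exists>\<beta> \<eta> \<zeta> \<theta>\<^sub>1 \<theta>\<^sub>2 \<rho>. equilibrium_point M (\<tau>, x, \<beta>, \<eta>, \<zeta>, \<theta>\<^sub>1, \<theta>\<^sub>2, \<rho>))"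
  unfolding equilibrium_point_iff KKT_point_def by (simp only: ex_simps)

theorem theorem4p1:
  fixes M :: "('s::finite, 'a, 'l::finite, 'k::finite) mdp_data"
    and \<tau> :: "real^'l" and x :: "real^'k"
  assumes "valid_data M"
    and "\<tau> \<noteq> 0" and "\<forall>k. x $ k < 0"
  shows "(\<forall>\<beta> \<eta> \<zeta> \<theta>\<^sub>1 \<theta>\<^sub>2 \<rho>.
            equilibrium_point M (\<tau>, x, \<beta>, \<eta>, \<zeta>, \<theta>\<^sub>1, \<theta>\<^sub>2, \<rho>) \<longrightarrow> KKT_point M \<tau> x)
       \<and> (KKT_point M \<tau> x \<longrightarrow>
            (\<exists>\<beta> \<eta> \<zeta> \<theta>\<^sub>1 \<theta>\<^sub>2 \<rho>.
               0 \<le> \<beta> \<and> 0 \<le> \<eta> \<and> 0 \<le> \<zeta> \<and> 0 \<le> \<theta>\<^sub>1 \<and> 0 \<le> \<theta>\<^sub>2 \<and> 0 \<le> \<rho> \<and>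
               equilibrium_point M (\<tau>, x, \<beta>, \<eta>, \<zeta>, \<theta>\<^sub>1, \<theta>\<^sub>2, \<rho>)))"
  \<comment> \<open>Unfolding the equilibrium condition exposes the nonnegativity of the witnesses:
    a fixed point of the projection is itself a positive part.\<close>
  using KKT_point_iff_equilibrium_point[of M \<tau> x]
  unfolding equilibrium_point_iff by blast

end
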